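(* Let $K$ be a field, $S=K[x_1,\ldots,x_n]$, and let $u\in S$ be a monomial of degree $d\geq 1$. Then $$\operatorname{slength}(S/(u))=d.$$
   Context: Let $M$ be a finitely generated $\mathbb Z^n$-graded $S$-module, $S=K[x_1,\ldots,x_n]$. A Stanley decomposition of $M$ is a finite direct sum of $K$-vector spaces $\mathcal D: M=\bigoplus_{i=1}^r m_iK[Z_i]$, where each $m_i\in M$ is homogeneous, $Z_i\subset\{x_1,\ldots,x_n\}$, and $m_iK[Z_i]$ is a free $K[Z_i]$-module. Its length is $\operatorname{slength}(\mathcal D)=r$, and the Stanley length of $M$ is $\operatorname{slength}(M)=\min\{\operatorname{slength}(\mathcal D):\mathcal D\text{ is a Stanley decomposition of }M\}$. *)

theory Defs
  imports
    "HOL-Library.Poly_Mapping"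
    "HOL-Library.Extended_Nat"
    "HOL-Algebra.QuotRing"
    "HOL-Algebra.Module"
    "HOL-Algebra.Algebraic_Closure_Type"
begin

text \<open>
  \<open>S = K[x\<^sub>1,\<dots>,x\<^sub>n]\<close>: the variables are indexed by the finite type \<open>'n\<close>, so that
  \<open>n = CARD('n)\<close>. A monomial is an exponent vector \<open>t :: 'n \<Rightarrow>\<^sub>0 nat\<close>, which as an
  element of \<open>S\<close> is \<open>Poly_Mapping.single t 1\<close>.
\<close>

type_synonym ('n, 'k) mpoly = "('n \<Rightarrow>\<^sub>0 nat) \<Rightarrow>\<^sub>0 'k"

abbreviation poly_ring :: "('n::finite, 'k::field) mpoly ring"
  where "poly_ring \<equiv> ring_of_type_algebra"

text \<open>The subring \<open>K[Z]\<close> of \<open>S\<close>, for a set \<open>Z\<close> of variables.\<close>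

definition polys_in :: "'n set \<Rightarrow> ('n::finite, 'k::field) mpoly set"
  where "polys_in Z = {p. \<forall>t \<in> Poly_Mapping.keys p. Poly_Mapping.keys t \<subseteq> Z}"

text \<open>
  The component of \<open>S\<close> of degree \<open>a \<in> \<int>\<^sup>n\<close>: it is \<open>K x\<^sup>a\<close> if \<open>a\<close> has no negative entry,
  and zero otherwise.
\<close>

definition poly_component :: "('n \<Rightarrow> int) \<Rightarrow> ('n::finite, 'k::field) mpoly set"
  where "poly_component a =
    {p. \<forall>t \<in> Poly_Mapping.keys p. \<forall>i. int (Poly_Mapping.lookup t i) = a i}"

text \<open>
  \<open>M\<close> is the internal direct sum of the additive subgroups \<open>V i\<close>, \<open>i \<in> I\<close>. When the
  \<open>V i\<close> are \<open>K\<close>-subspaces, this is the direct sum as \<open>K\<close>-vector spaces.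
\<close>

definition is_direct_sum :: "('m, 'b) ring_scheme \<Rightarrow> 'i set \<Rightarrow> ('i \<Rightarrow> 'm set) \<Rightarrow> bool"
  where "is_direct_sum M I V \<longleftrightarrow>
    (\<forall>i\<in>I. additive_subgroup (V i) M) \<and>
    (\<forall>x\<in>carrier M. \<exists>!f. f \<in> (\<Pi>\<^sub>E i\<in>I. V i) \<and> finite {i\<in>I. f i \<noteq> \<zero>\<^bsub>M\<^esub>} \<and>
       x = (\<Oplus>\<^bsub>M\<^esub>i\<in>{i\<in>I. f i \<noteq> \<zero>\<^bsub>M\<^esub>}. f i))"

text \<open>Finitely generated \<open>\<int>\<^sup>n\<close>-graded \<open>S\<close>-modules; \<open>G a\<close> is the component of degree \<open>a\<close>.\<close>

definition fg_graded_module ::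
    "(('n::finite, 'k::field) mpoly, 'm) module \<Rightarrow> (('n \<Rightarrow> int) \<Rightarrow> 'm set) \<Rightarrow> bool"
  where "fg_graded_module M G \<longleftrightarrow>
    module poly_ring M \<and>
    (\<exists>F. finite F \<and> F \<subseteq> carrier M \<and>
      (\<forall>x\<in>carrier M. \<exists>c. x = (\<Oplus>\<^bsub>M\<^esub>g\<in>F. c g \<odot>\<^bsub>M\<^esub> g))) \<and>
    is_direct_sum M UNIV G \<and>
    (\<forall>a b. \<forall>p\<in>poly_component a. \<forall>x\<in>G b. p \<odot>\<^bsub>M\<^esub> x \<in> G (\<lambda>i. a i + b i))"

text \<open>The space \<open>m K[Z]\<close>.\<close>

definition stanley_space :: "(('n::finite, 'k::field) mpoly, 'm) module \<Rightarrow> 'm \<Rightarrow> 'n set \<Rightarrow> 'm set"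
  where "stanley_space M m Z = (\<lambda>p. p \<odot>\<^bsub>M\<^esub> m) ` polys_in Z"

text \<open>
  The family \<open>(m\<^sub>i, Z\<^sub>i)\<close> is given as a list, whose length is the length of the
  decomposition. That \<open>m\<^sub>i K[Z\<^sub>i]\<close> is a free \<open>K[Z\<^sub>i]\<close>-module means that it is free
  on \<open>m\<^sub>i\<close>; this excludes \<open>m\<^sub>i = 0\<close>.
\<close>

definition stanley_decomposition ::
    "(('n::finite, 'k::field) mpoly, 'm) module \<Rightarrow> (('n \<Rightarrow> int) \<Rightarrow> 'm set) \<Rightarrow> ('m \<times> 'n set) list \<Rightarrow> bool"
  where "stanley_decomposition M G D \<longleftrightarrow>
    (\<forall>(m, Z)\<in>set D. m \<in> carrier M \<and> (\<exists>a. m \<in> G a) \<and> inj_on (\<lambda>p. p \<odot>\<^bsub>M\<^esub> m) (polys_in Z)) \<and>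
    is_direct_sum M {..<length D} (\<lambda>i. stanley_space M (fst (D ! i)) (snd (D ! i)))"

text \<open>
  The infimum is taken in \<^typ>\<open>enat\<close>: it is \<open>\<infinity>\<close> if there is no Stanley decomposition, and
  an attained minimum otherwise.
\<close>

definition slength :: "(('n::finite, 'k::field) mpoly, 'm) module \<Rightarrow> (('n \<Rightarrow> int) \<Rightarrow> 'm set) \<Rightarrow> enat"
  where "slength M G = (INF D \<in> {D. stanley_decomposition M G D}. enat (length D))"

text \<open>
  \<open>S/(u)\<close> as an \<open>S\<close>-module: the quotient ring, on which \<open>r \<in> S\<close> acts by multiplication with
  its residue class.
\<close>

definition quot_module :: "('n::finite, 'k::field) mpoly \<Rightarrow> (('n, 'k) mpoly, ('n, 'k) mpoly set) module"
  where "quot_module u = (let I = PIdl\<^bsub>poly_ring\<^esub> u; Q = poly_ring Quot I in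
    \<lparr>carrier = carrier Q, monoid.mult = monoid.mult Q, one = \<one>\<^bsub>Q\<^esub>, zero = \<zero>\<^bsub>Q\<^esub>, add = add Q,
     module.smult = (\<lambda>r A. (I +>\<^bsub>poly_ring\<^esub> r) \<otimes>\<^bsub>Q\<^esub> A)\<rparr>)"

definition quot_grading :: "('n::finite, 'k::field) mpoly \<Rightarrow> ('n \<Rightarrow> int) \<Rightarrow> ('n, 'k) mpoly set set"
  where "quot_grading u a = (\<lambda>p. PIdl\<^bsub>poly_ring\<^esub> u +>\<^bsub>poly_ring\<^esub> p) ` poly_component a"

text \<open>
  For a monomial \<open>u\<close>, these data do make \<open>S/(u)\<close> a finitely generated \<open>\<int>\<^sup>n\<close>-graded
  \<open>S\<close>-module: see \<open>fg_graded_quot_module\<close> below.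
\<close>

lemma poly_ring_simps [simp]:
  "carrier poly_ring = UNIV" "x \<otimes>\<^bsub>poly_ring\<^esub> y = x * y" "x \<oplus>\<^bsub>poly_ring\<^esub> y = x + y"
  "\<one>\<^bsub>poly_ring\<^esub> = 1" "\<zero>\<^bsub>poly_ring\<^esub> = 0"
  by (simp_all add: ring_of_type_algebra_def)

lemma cring_poly_ring: "cring poly_ring"
  by (rule cring_from_type_algebra)

lemma ideal_PIdl: "ideal (PIdl\<^bsub>poly_ring\<^esub> u) poly_ring"
  using cring.cgenideal_ideal[OF cring_poly_ring] by simp

lemma mem_PIdl: "p \<in> PIdl\<^bsub>poly_ring\<^esub> u \<longleftrightarrow> (\<exists>x. p = x * u)"
  by (auto simp: cgenideal_def)

abbreviation quot_class :: "('n::finite, 'k::field) mpoly \<Rightarrow> ('n, 'k) mpoly \<Rightarrow> ('n, 'k) mpoly set"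
  where "quot_class u p \<equiv> PIdl\<^bsub>poly_ring\<^esub> u +>\<^bsub>poly_ring\<^esub> p"

lemma quot_class_eq_iff: "quot_class u p = quot_class u q \<longleftrightarrow> u dvd p - q"
proof -
  have *: "quot_class u p = {x * u + p | x. True}" for p
    by (auto simp: a_r_coset_def' cgenideal_def)
  show ?thesis
  proof
    assume "quot_class u p = quot_class u q"
    moreover have "0 * u + p \<in> quot_class u p" unfolding * by blast
    ultimately obtain x where "p = x * u + q" unfolding * by auto
    then show "u dvd p - q" by simp
  next
    assume "u dvd p - q"
    then obtain y where y: "p = q + u * y" by (metis add.commute diff_add_cancel dvd_def)
    have "x * u + p = (x + y) * u + q" "x * u + q = (x - y) * u + p" for x
      by (simp_all add: y algebra_simps)
    then show "quot_class u p = quot_class u q" unfolding * by blast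
  qed
qed

lemma quot_module_simps:
  "carrier (quot_module u) = range (quot_class u)"
  "quot_class u p \<oplus>\<^bsub>quot_module u\<^esub> quot_class u q = quot_class u (p + q)"
  "r \<odot>\<^bsub>quot_module u\<^esub> quot_class u p = quot_class u (r * p)"
  "\<zero>\<^bsub>quot_module u\<^esub> = quot_class u 0"
proof -
  interpret ideal "PIdl\<^bsub>poly_ring\<^esub> u" "poly_ring" by (rule ideal_PIdl)
  show "carrier (quot_module u) = range (quot_class u)"
    by (auto simp: quot_module_def Let_def FactRing_def A_RCOSETS_def' a_r_coset_def')
  show "quot_class u p \<oplus>\<^bsub>quot_module u\<^esub> quot_class u q = quot_class u (p + q)"
    using a_rcos_sum[of p q] by (simp add: quot_module_def Let_def FactRing_def)
  show "r \<odot>\<^bsub>quot_module u\<^esub> quot_class u p = quot_class u (r * p)"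
    using rcoset_mult_add[of r p] by (simp add: quot_module_def Let_def FactRing_def)
  have "quot_class u 0 = PIdl\<^bsub>poly_ring\<^esub> u"
    by (auto simp: a_r_coset_def')
  then show "\<zero>\<^bsub>quot_module u\<^esub> = quot_class u 0"
    by (simp add: quot_module_def Let_def FactRing_def)
qed

lemma module_quot_module: "module poly_ring (quot_module u)"
proof (rule moduleI)
  show "abelian_group (quot_module u)"
  proof (rule abelian_groupI)
    fix x assume "x \<in> carrier (quot_module u)"
    then obtain p where x: "x = quot_class u p" by (auto simp: quot_module_simps)
    show "\<exists>y\<in>carrier (quot_module u). y \<oplus>\<^bsub>quot_module u\<^esub> x = \<zero>\<^bsub>quot_module u\<^esub>"
      by (rule bexI[of _ "quot_class u (- p)"]) (simp_all add: x quot_module_simps)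
  qed (auto simp: quot_module_simps algebra_simps)
qed (use cring_poly_ring in \<open>auto simp: quot_module_simps algebra_simps\<close>)

lemma finsum_quot_class:
  "finite A \<Longrightarrow> (\<Oplus>\<^bsub>quot_module u\<^esub>i\<in>A. quot_class u (f i)) = quot_class u (sum f A)"
proof -
  interpret module poly_ring "quot_module u" by (rule module_quot_module)
  show "finite A \<Longrightarrow> ?thesis"
    by (induction A rule: finite_induct) (auto simp: quot_module_simps Pi_def)
qed

text \<open>The homogeneous part of degree \<open>a\<close> of a polynomial.\<close>

definition graded_part :: "('n \<Rightarrow> int) \<Rightarrow> ('n::finite, 'k::field) mpoly \<Rightarrow> ('n, 'k) mpoly" where
  "graded_part a p = (if \<exists>s. a = int \<circ> Poly_Mapping.lookup s then
     (let s = (THE s. a = int \<circ> Poly_Mapping.lookup s) in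
        Poly_Mapping.single s (Poly_Mapping.lookup p s)) else 0)"

lemma lookup_part:
  fixes a :: "'n::finite \<Rightarrow> int" and p :: "('n, 'k::field) mpoly"
  shows "Poly_Mapping.lookup (graded_part a p) s = (if a = int \<circ> Poly_Mapping.lookup s then Poly_Mapping.lookup p s else 0)"
proof -
  have inj: "s = s'" if "int \<circ> Poly_Mapping.lookup s = int \<circ> Poly_Mapping.lookup s'" for s s' :: "'n \<Rightarrow>\<^sub>0 nat"
    using that by (intro poly_mapping_eqI) (auto simp: fun_eq_iff)
  show ?thesis
  proof (cases "\<exists>s. a = int \<circ> Poly_Mapping.lookup s")
    case True
    then obtain s' where a: "a = int \<circ> Poly_Mapping.lookup s'" by blast
    have "(THE s. a = int \<circ> Poly_Mapping.lookup s) = s'"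
      by (rule the_equality) (use a inj in metis)+
    then show ?thesis using a inj True by (auto simp: graded_part_def lookup_single when_def)
  qed (auto simp: graded_part_def)
qed

lemma part_component: "graded_part a p \<in> poly_component a"
  by (auto simp: poly_component_def in_keys_iff lookup_part split: if_splits)

lemma part_of_component: "q \<in> poly_component b \<Longrightarrow> graded_part a q = (if a = b then q else 0)"
  by (rule poly_mapping_eqI)
     (fastforce simp: poly_component_def in_keys_iff lookup_part fun_eq_iff)

lemma part_add: "graded_part a (p + q) = graded_part a p + graded_part a q"
  and part_diff: "graded_part a (p - q) = graded_part a p - graded_part a q"
  by (rule poly_mapping_eqI; simp add: lookup_part lookup_add lookup_minus)+

lemma part_sum: "graded_part a (sum f A) = (\<Sum>i\<in>A. graded_part a (f i))"
  by (rule poly_mapping_eqI) (simp add: lookup_part lookup_sum)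

lemma part_zero [simp]: "graded_part a 0 = 0"
  by (rule poly_mapping_eqI) (simp add: lookup_part)

lemma dvd_part:
  fixes u :: "('n::finite, 'k::field) mpoly"
  assumes u: "u = Poly_Mapping.single t 1" and "u dvd p"
  shows "u dvd graded_part a p"
proof (cases "\<exists>s. a = int \<circ> Poly_Mapping.lookup s")
  case True
  then obtain s where a: "a = int \<circ> Poly_Mapping.lookup s" by blast
  have inj: "s = s'" if "int \<circ> Poly_Mapping.lookup s = int \<circ> Poly_Mapping.lookup s'" for s'
    using that by (intro poly_mapping_eqI) (auto simp: fun_eq_iff)
  have eq: "graded_part a p = Poly_Mapping.single s (Poly_Mapping.lookup p s)"
    by (rule poly_mapping_eqI) (auto simp: lookup_part a lookup_single when_def dest: inj)
  show ?thesis
  proof (cases "s \<in> Poly_Mapping.keys p")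
    case True
    obtain x where "p = u * x" using assms by (auto simp: dvd_def)
    with True keys_mult[of u x] obtain k where "s = t + k" by (auto simp: u)
    then have "graded_part a p = u * Poly_Mapping.single k (Poly_Mapping.lookup p s)"
      by (simp add: eq u mult_single)
    then show ?thesis by simp
  qed (simp add: eq in_keys_iff)
qed (simp add: graded_part_def)

lemma sum_graded_part:
  assumes "finite A" "(\<lambda>s. int \<circ> Poly_Mapping.lookup s) ` Poly_Mapping.keys p \<subseteq> A"
  shows "(\<Sum>a\<in>A. graded_part a p) = p"
proof (rule poly_mapping_eqI)
  fix s
  have "(int \<circ> Poly_Mapping.lookup s) \<in> A \<or> Poly_Mapping.lookup p s = 0"
    using assms(2) by (auto simp: in_keys_iff)
  then show "Poly_Mapping.lookup (\<Sum>a\<in>A. graded_part a p) s = Poly_Mapping.lookup p s"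
    using assms(1) by (auto simp: lookup_sum lookup_part sum.delta)
qed

lemma is_direct_sum_quot:
  fixes u :: "('n::finite, 'k::field) mpoly"
  assumes u: "u = Poly_Mapping.single t 1"
  shows "is_direct_sum (quot_module u) UNIV (quot_grading u)"
proof -
  let ?M = "quot_module u" let ?G = "quot_grading u"
  interpret module poly_ring ?M by (rule module_quot_module)
  have car: "quot_class u p \<in> carrier ?M" for p by (simp add: quot_module_simps)
  have sub: "additive_subgroup (?G a) ?M" for a
  proof (rule additive_subgroup.intro, rule M.add.subgroupI)
    show "?G a \<subseteq> carrier ?M" by (auto simp: quot_grading_def car)
    have "0 \<in> poly_component a" by (simp add: poly_component_def)
    then show "?G a \<noteq> {}" by (auto simp: quot_grading_def)
    fix x assume "x \<in> ?G a"
    then obtain p where p: "p \<in> poly_component a" "x = quot_class u p" by (auto simp: quot_grading_def)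
    have "\<ominus>\<^bsub>?M\<^esub> x = quot_class u (- p)"
      by (rule M.minus_equality) (auto simp: p quot_module_simps)
    moreover have "- p \<in> poly_component a" using p by (simp add: poly_component_def)
    ultimately show "\<ominus>\<^bsub>?M\<^esub> x \<in> ?G a"
      by (auto simp: quot_grading_def)
    fix y assume "y \<in> ?G a"
    then obtain q where q: "q \<in> poly_component a" "y = quot_class u q" by (auto simp: quot_grading_def)
    have "p + q \<in> poly_component a"
      using p(1) q(1) keys_add[of p q] by (auto simp: poly_component_def)
    then show "x \<oplus>\<^bsub>?M\<^esub> y \<in> ?G a"
      by (auto simp: p q quot_module_simps quot_grading_def)
  qed
  have "\<exists>!f. f \<in> (\<Pi>\<^sub>E i\<in>UNIV. ?G i) \<and> finite {i\<in>UNIV. f i \<noteq> \<zero>\<^bsub>?M\<^esub>} \<and>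
       x = (\<Oplus>\<^bsub>?M\<^esub>i\<in>{i\<in>UNIV. f i \<noteq> \<zero>\<^bsub>?M\<^esub>}. f i)" if "x \<in> carrier ?M" for x
  proof -
    from that obtain p where x: "x = quot_class u p" by (auto simp: quot_module_simps)
    let ?f = "\<lambda>a. quot_class u (graded_part a p)"
    let ?A = "(\<lambda>s. int \<circ> Poly_Mapping.lookup s) ` Poly_Mapping.keys p"
    have supp: "{i\<in>UNIV. ?f i \<noteq> \<zero>\<^bsub>?M\<^esub>} \<subseteq> ?A"
    proof
      fix a assume "a \<in> {i\<in>UNIV. ?f i \<noteq> \<zero>\<^bsub>?M\<^esub>}"
      then have "graded_part a p \<noteq> 0" by (auto simp: quot_module_simps)
      then obtain s where "Poly_Mapping.lookup (graded_part a p) s \<noteq> 0"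
        by (metis lookup_zero poly_mapping_eqI)
      then show "a \<in> ?A" by (auto simp: lookup_part in_keys_iff split: if_splits)
    qed
    have fin: "finite {i\<in>UNIV. ?f i \<noteq> \<zero>\<^bsub>?M\<^esub>}" by (rule finite_subset[OF supp]) simp
    have "(\<Oplus>\<^bsub>?M\<^esub>i\<in>{i\<in>UNIV. ?f i \<noteq> \<zero>\<^bsub>?M\<^esub>}. ?f i) = (\<Oplus>\<^bsub>?M\<^esub>i\<in>?A. ?f i)"
      by (rule M.add.finprod_mono_neutral_cong_left[OF _ supp]) (auto simp: car)
    also have "\<dots> = x" by (simp add: finsum_quot_class sum_graded_part x)
    finally have sum: "x = (\<Oplus>\<^bsub>?M\<^esub>i\<in>{i\<in>UNIV. ?f i \<noteq> \<zero>\<^bsub>?M\<^esub>}. ?f i)" ..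
    show ?thesis
    proof (rule ex1I[of _ ?f])
      show "?f \<in> (\<Pi>\<^sub>E i\<in>UNIV. ?G i) \<and> finite {i\<in>UNIV. ?f i \<noteq> \<zero>\<^bsub>?M\<^esub>} \<and>
          x = (\<Oplus>\<^bsub>?M\<^esub>i\<in>{i\<in>UNIV. ?f i \<noteq> \<zero>\<^bsub>?M\<^esub>}. ?f i)"
        using sum fin by (auto simp: quot_grading_def part_component)
      fix f assume f: "f \<in> (\<Pi>\<^sub>E i\<in>UNIV. ?G i) \<and> finite {i\<in>UNIV. f i \<noteq> \<zero>\<^bsub>?M\<^esub>} \<and>
          x = (\<Oplus>\<^bsub>?M\<^esub>i\<in>{i\<in>UNIV. f i \<noteq> \<zero>\<^bsub>?M\<^esub>}. f i)"
      let ?B = "{i\<in>UNIV. f i \<noteq> \<zero>\<^bsub>?M\<^esub>}"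
      from f have "\<forall>a. \<exists>g. g \<in> poly_component a \<and> f a = quot_class u g"
        by (auto simp: quot_grading_def)
      then obtain g where g: "\<And>a. g a \<in> poly_component a" "\<And>a. f a = quot_class u (g a)"
        by metis
      from f have "x = (\<Oplus>\<^bsub>?M\<^esub>i\<in>?B. quot_class u (g i))" unfolding g(2) by blast
      also have "\<dots> = quot_class u (sum g ?B)" using f finsum_quot_class by blast
      finally have dvd: "u dvd p - sum g ?B" unfolding x quot_class_eq_iff .
      show "f = ?f"
      proof
        fix a
        have eq: "graded_part a (p - sum g ?B) = graded_part a p - (if a \<in> ?B then g a else 0)"
          using f by (simp add: part_diff part_sum part_of_component[OF g(1)])
        have "u dvd graded_part a p - (if a \<in> ?B then g a else 0)"
          using dvd_part[OF u dvd, of a] unfolding eq .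
        then have "?f a = quot_class u (if a \<in> ?B then g a else 0)" unfolding quot_class_eq_iff .
        also have "\<dots> = f a" by (auto simp: g(2) quot_module_simps)
        finally show "f a = ?f a" ..
      qed
    qed
  qed
  then show ?thesis unfolding is_direct_sum_def
    by (intro conjI ballI sub) simp_all
qed

lemma fg_graded_quot_module:
  fixes u :: "('n::finite, 'k::field) mpoly"
  assumes "u = Poly_Mapping.single t 1"
  shows "fg_graded_module (quot_module u) (quot_grading u)"
  unfolding fg_graded_module_def
proof (intro conjI allI ballI)
  interpret module poly_ring "quot_module u" by (rule module_quot_module)
  show "module poly_ring (quot_module u)" by (rule module_quot_module)
  show "is_direct_sum (quot_module u) UNIV (quot_grading u)" by (rule is_direct_sum_quot[OF assms])
  show "\<exists>F. finite F \<and> F \<subseteq> carrier (quot_module u) \<and>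
      (\<forall>x\<in>carrier (quot_module u). \<exists>c. x = (\<Oplus>\<^bsub>quot_module u\<^esub>g\<in>F. c g \<odot>\<^bsub>quot_module u\<^esub> g))"
  proof (rule exI[of _ "{quot_class u 1}"], intro conjI ballI)
    fix x assume "x \<in> carrier (quot_module u)"
    then obtain p where "x = quot_class u p" by (auto simp: quot_module_simps)
    then show "\<exists>c. x = (\<Oplus>\<^bsub>quot_module u\<^esub>g\<in>{quot_class u 1}. c g \<odot>\<^bsub>quot_module u\<^esub> g)"
      by (intro exI[of _ "\<lambda>_. p"]) (simp add: quot_module_simps)
  qed (auto simp: quot_module_simps)
  fix a b :: "'n \<Rightarrow> int" and p :: "('n, 'k) mpoly" and x
  assume p: "p \<in> poly_component a" and "x \<in> quot_grading u b"
  then obtain q where q: "q \<in> poly_component b" "x = quot_class u q" by (auto simp: quot_grading_def)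
  have "p * q \<in> poly_component (\<lambda>i. a i + b i)"
    using p q(1) keys_mult[of p q] by (fastforce simp: poly_component_def lookup_add)
  then show "p \<odot>\<^bsub>quot_module u\<^esub> x \<in> quot_grading u (\<lambda>i. a i + b i)"
    by (auto simp: q quot_module_simps quot_grading_def)
qed

end

theory Submission
  imports Defs "HOL-Library.Disjoint_Sets"
begin

text \<open>
  A monomial basis of \<open>S/(u)\<close>, \<open>u = x\<^sup>t\<close>, is given by the exponents \<open>s\<close> that do not lie in
  \<open>t + \<nat>\<^sup>n\<close>.

  For \<open>slength \<le> d\<close>, write \<open>u\<close> as a product of \<open>d\<close> variables. The partial products form a chain
  \<open>1 = v\<^sub>0, v\<^sub>1, \<dots>, v\<^sub>d = u\<close> with \<open>v\<^bsub>l+1\<^esub> = v\<^sub>l x\<^sub>i\<close>, and the monomials in \<open>(v\<^sub>l)\<close> but not in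
  \<open>(v\<^bsub>l+1\<^esub>)\<close> are those of \<open>v\<^sub>l K[x\<^sub>j | j \<noteq> i]\<close>.

  For \<open>slength \<ge> d\<close>, take a variable \<open>i\<close> and \<open>k < t\<^sub>i\<close>, and let \<open>s\<close> have \<open>i\<close>-th entry \<open>k\<close> and all
  other entries equal to a large number. A Stanley space \<open>m K[Z]\<close> covering \<open>x\<^sup>s\<close> must have all
  variables except \<open>i\<close> in \<open>Z\<close>, while \<open>Z\<close> cannot contain all variables because \<open>u m = 0\<close>. Hence
  \<open>i\<close> is the one variable missing from \<open>Z\<close>, and \<open>k\<close> is the \<open>i\<close>-th entry of the degree of \<open>m\<close>,
  so the \<open>d\<close> pairs \<open>(i, k)\<close> need \<open>d\<close> different spaces.
\<close>

section \<open>Cones of exponents\<close>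

text \<open>These are the exponents of the monomials in \<open>x^a K[Z]\<close>; in particular
  \<open>cone t UNIV\<close> collects the exponents of the monomials divisible by
  \<open>x^t\<close>.\<close>

definition cone :: "('n \<Rightarrow>\<^sub>0 nat) \<Rightarrow> 'n set \<Rightarrow> ('n \<Rightarrow>\<^sub>0 nat) set"
  where "cone a Z = {a + b | b. Poly_Mapping.keys b \<subseteq> Z}"

lemma mem_cone_iff:
  "s \<in> cone a Z \<longleftrightarrow>
    (\<forall>i. if i \<in> Z then Poly_Mapping.lookup a i \<le> Poly_Mapping.lookup s i
         else Poly_Mapping.lookup s i = Poly_Mapping.lookup a i)"
proof
  assume "s \<in> cone a Z"
  then show "\<forall>i. if i \<in> Z then Poly_Mapping.lookup a i \<le> Poly_Mapping.lookup s i
         else Poly_Mapping.lookup s i = Poly_Mapping.lookup a i"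
    by (auto simp: cone_def lookup_add in_keys_iff)
next
  assume *: "\<forall>i. if i \<in> Z then Poly_Mapping.lookup a i \<le> Poly_Mapping.lookup s i
         else Poly_Mapping.lookup s i = Poly_Mapping.lookup a i"
  have "Poly_Mapping.lookup a i \<le> Poly_Mapping.lookup s i" for i
    using *[rule_format, of i] by (auto split: if_splits)
  \<comment> \<open>Subtraction of exponents is truncated, so the entrywise bound has to come
    first.\<close>
  then have "s = a + (s - a)"
    by (intro poly_mapping_eqI) (simp add: lookup_add lookup_minus)
  moreover have "Poly_Mapping.keys (s - a) \<subseteq> Z"
  proof
    fix i assume "i \<in> Poly_Mapping.keys (s - a)"
    then show "i \<in> Z"
      using *[rule_format, of i] by (cases "i \<in> Z") (auto simp: in_keys_iff lookup_minus)
  qed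
  ultimately show "s \<in> cone a Z" unfolding cone_def by blast
qed

text \<open>Induction on the degree, lowering \<open>t\<close> to \<open>t'\<close> in one entry
  \<open>i\<close>. An exponent above \<open>t'\<close> but not above \<open>t\<close> agrees with
  \<open>t'\<close> in entry \<open>i\<close> and is free to grow in all others, so the complement
  gains exactly one cone.\<close>

lemma cone_chain_partition:
  fixes t :: "'n::finite \<Rightarrow>\<^sub>0 nat"
  assumes "(\<Sum>i\<in>UNIV. Poly_Mapping.lookup t i) = d"
  shows "\<exists>a Z. disjoint_family_on (\<lambda>l. cone (a l) (Z l)) {..<d} \<and>
    (\<Union>l<d. cone (a l) (Z l)) = - cone t UNIV"
  using assms
proof (induction d arbitrary: t)
  case 0
  then have "cone t UNIV = UNIV" by (auto simp: mem_cone_iff)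
  then show ?case by (auto simp: disjoint_family_on_def)
next
  case (Suc d)
  then obtain i where i: "Poly_Mapping.lookup t i > 0"
    by (metis gr0I sum.neutral Zero_not_Suc)
  define t' where "t' = t - Poly_Mapping.single i 1"
  have lt: "Poly_Mapping.lookup t j = Poly_Mapping.lookup t' j + (if j = i then 1 else 0)" for j
    using i by (auto simp: t'_def lookup_minus lookup_single when_def)
  have "(\<Sum>i\<in>UNIV. Poly_Mapping.lookup t' i) = d"
    using Suc.prems by (simp add: lt sum.distrib)
  from Suc.IH[OF this] obtain a Z where
    disj: "disjoint_family_on (\<lambda>l. cone (a l) (Z l)) {..<d}" and
    un: "(\<Union>l<d. cone (a l) (Z l)) = - cone t' UNIV" by blast
  have new: "- cone t UNIV = - cone t' UNIV \<union> cone t' (- {i})"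
    "cone t' (- {i}) \<subseteq> cone t' UNIV"
  proof -
    show "cone t' (- {i}) \<subseteq> cone t' UNIV"
      by (auto simp: cone_def)
    have "s \<notin> cone t UNIV \<longleftrightarrow> s \<notin> cone t' UNIV \<or> s \<in> cone t' (- {i})" for s
    proof (cases "s \<in> cone t' UNIV")
      case True
      then have le: "Poly_Mapping.lookup t' j \<le> Poly_Mapping.lookup s j" for j
        by (simp add: mem_cone_iff)
      have "s \<in> cone t UNIV \<longleftrightarrow> Poly_Mapping.lookup t' i < Poly_Mapping.lookup s i"
        using le by (auto simp: mem_cone_iff lt Suc_le_eq)
      moreover have "s \<in> cone t' (- {i}) \<longleftrightarrow> Poly_Mapping.lookup s i = Poly_Mapping.lookup t' i"
        using le by (auto simp: mem_cone_iff)
      ultimately show ?thesis using True le[of i] by auto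
    next
      case False
      then have "s \<notin> cone t UNIV"
        unfolding mem_cone_iff lt by (metis UNIV_I add_leD1)
      with False show ?thesis by blast
    qed
    then show "- cone t UNIV = - cone t' UNIV \<union> cone t' (- {i})" by blast
  qed
  \<comment> \<open>The new cone takes index \<open>d\<close> and leaves the earlier ones
    unchanged.\<close>
  let ?C = "\<lambda>l. cone ((a(d := t')) l) ((Z(d := - {i})) l)"
  have C: "?C l = cone (a l) (Z l)" if "l < d" for l using that by simp
  have Cd: "?C d = cone t' (- {i})" by simp
  have "disjoint_family_on ?C {..<Suc d}"
    unfolding lessThan_Suc disjoint_family_on_insert[of d "{..<d}", simplified]
    using disj un new(2) by (fastforce simp: disjoint_family_on_def)
  moreover have "(\<Union>l<Suc d. ?C l) = - cone t UNIV"
    using un new(1) by (simp add: lessThan_Suc Un_commute)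
  ultimately show ?case by blast
qed

section \<open>Supports of polynomials and multiplication by a monomial\<close>

lemma sum_single_lookup:
  "(\<Sum>s\<in>Poly_Mapping.keys p. Poly_Mapping.single s (Poly_Mapping.lookup p s)) = p"
  by (rule poly_mapping_eqI) (simp add: lookup_sum lookup_single when_def, simp add: in_keys_iff)

lemma mult_single_eq_sum:
  fixes p :: "'a::comm_monoid_add \<Rightarrow>\<^sub>0 'k::comm_semiring_1"
  shows "p * Poly_Mapping.single a 1 =
    (\<Sum>s\<in>Poly_Mapping.keys p. Poly_Mapping.single (s + a) (Poly_Mapping.lookup p s))"
proof -
  have "p * Poly_Mapping.single a 1 =
      (\<Sum>s\<in>Poly_Mapping.keys p. Poly_Mapping.single s (Poly_Mapping.lookup p s))
        * Poly_Mapping.single a 1"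
    by (simp only: sum_single_lookup)
  then show ?thesis by (simp add: sum_distrib_right mult_single)
qed

text \<open>Shifting exponents causes no collisions; this is what later allows a monomial factor to
  be cancelled.\<close>

lemma lookup_mult_single:
  fixes a s :: "'n \<Rightarrow>\<^sub>0 nat" and p :: "('n \<Rightarrow>\<^sub>0 nat) \<Rightarrow>\<^sub>0 'k::comm_semiring_1"
  shows "Poly_Mapping.lookup (p * Poly_Mapping.single a 1) (s + a) = Poly_Mapping.lookup p s"
  by (simp add: mult_single_eq_sum lookup_sum lookup_single when_def, simp add: in_keys_iff)

lemma keys_mult_single_subset_cone:
  fixes p :: "('n::finite, 'k::field) mpoly"
  assumes "p \<in> polys_in Z"
  shows "Poly_Mapping.keys (p * Poly_Mapping.single a 1) \<subseteq> cone a Z"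
proof
  fix s assume "s \<in> Poly_Mapping.keys (p * Poly_Mapping.single a 1)"
  with keys_mult[of p "Poly_Mapping.single a 1"]
  obtain b where "b \<in> Poly_Mapping.keys p" "s = a + b" by (fastforce simp: add.commute)
  then show "s \<in> cone a Z" using assms by (auto simp: cone_def polys_in_def)
qed

text \<open>Subtracting \<open>a\<close> from every exponent of \<open>q\<close> undoes the shift;
  truncation does no harm because each exponent has the form \<open>a + b\<close>.\<close>

lemma keys_subset_cone_imp_mult_single:
  fixes q :: "('n::finite, 'k::field) mpoly"
  assumes "Poly_Mapping.keys q \<subseteq> cone a Z"
  obtains p where "p \<in> polys_in Z" "q = p * Poly_Mapping.single a 1"
proof
  let ?p = "\<Sum>s\<in>Poly_Mapping.keys q. Poly_Mapping.single (s - a) (Poly_Mapping.lookup q s)"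
  have sub: "s - a + a = s" "Poly_Mapping.keys (s - a) \<subseteq> Z" if "s \<in> Poly_Mapping.keys q" for s
    using that assms by (fastforce simp: cone_def add.commute)+
  have "Poly_Mapping.keys ?p \<subseteq> (\<Union>s\<in>Poly_Mapping.keys q. {s - a})"
    by (rule order_trans[OF keys_sum]) (auto split: if_splits)
  then show "?p \<in> polys_in Z" using sub(2) by (fastforce simp: polys_in_def)
  have "q = (\<Sum>s\<in>Poly_Mapping.keys q. Poly_Mapping.single s (Poly_Mapping.lookup q s))"
    by (simp only: sum_single_lookup)
  also have "\<dots> = ?p * Poly_Mapping.single a 1"
    by (simp add: sum_distrib_right mult_single sub(1))
  finally show "q = ?p * Poly_Mapping.single a 1" .
qed

text \<open>Together with \<open>quot_class_eq_iff\<close>, this turns equality of residue classes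
  into a condition on supports.\<close>

lemma monomial_dvd_iff:
  fixes p :: "('n::finite, 'k::field) mpoly"
  shows "Poly_Mapping.single t 1 dvd p \<longleftrightarrow> Poly_Mapping.keys p \<subseteq> cone t UNIV"
proof
  assume "Poly_Mapping.single t 1 dvd p"
  then obtain q where "p = q * Poly_Mapping.single t 1" by (metis dvd_def mult.commute)
  then show "Poly_Mapping.keys p \<subseteq> cone t UNIV"
    using keys_mult_single_subset_cone[of q UNIV t] by (simp add: polys_in_def)
next
  assume "Poly_Mapping.keys p \<subseteq> cone t UNIV"
  then show "Poly_Mapping.single t 1 dvd p"
    by (rule keys_subset_cone_imp_mult_single) simp
qed

text \<open>Used to cut a polynomial along a cone. As \<open>B\<close> may be infinite, the witness
  sums only over the exponents of \<open>p\<close> in \<open>B\<close>.\<close>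

lemma ex_restriction:
  fixes p :: "'a \<Rightarrow>\<^sub>0 'b::comm_monoid_add"
  shows "\<exists>q. \<forall>s. Poly_Mapping.lookup q s = (if s \<in> B then Poly_Mapping.lookup p s else 0)"
proof (intro exI allI)
  fix s
  show "Poly_Mapping.lookup (\<Sum>s\<in>Poly_Mapping.keys p \<inter> B.
      Poly_Mapping.single s (Poly_Mapping.lookup p s)) s
    = (if s \<in> B then Poly_Mapping.lookup p s else 0)"
    by (auto simp: lookup_sum lookup_single when_def in_keys_iff)
qed

section \<open>Stanley spaces and direct sums in the quotient\<close>

lemma stanley_space_quot:
  "stanley_space (quot_module u) (quot_class u (Poly_Mapping.single a 1)) Z =
    quot_class u ` {q. Poly_Mapping.keys q \<subseteq> cone a Z}"
  (is "?L = ?R")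
proof
  show "?L \<subseteq> ?R"
    using keys_mult_single_subset_cone by (fastforce simp: stanley_space_def quot_module_simps)
  show "?R \<subseteq> ?L"
  proof
    fix x assume "x \<in> ?R"
    then obtain q where "Poly_Mapping.keys q \<subseteq> cone a Z" "x = quot_class u q" by blast
    then show "x \<in> ?L"
      by (auto elim!: keys_subset_cone_imp_mult_single simp: stanley_space_def quot_module_simps)
  qed
qed

text \<open>The sum in \<open>is_direct_sum\<close> skips zero components; putting them back gives
  one sum of representatives over the whole index set.\<close>

lemma finsum_quot_class_nonzero:
  assumes "finite I" "\<And>i. i \<in> I \<Longrightarrow> f i = quot_class u (g i)"
  shows "(\<Oplus>\<^bsub>quot_module u\<^esub>i\<in>{i\<in>I. f i \<noteq> \<zero>\<^bsub>quot_module u\<^esub>}. f i) = quot_class u (sum g I)"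
proof -
  interpret module poly_ring "quot_module u" by (rule module_quot_module)
  have car: "quot_class u p \<in> carrier (quot_module u)" for p by (simp add: quot_module_simps)
  have "(\<Oplus>\<^bsub>quot_module u\<^esub>i\<in>{i\<in>I. f i \<noteq> \<zero>\<^bsub>quot_module u\<^esub>}. f i)
      = (\<Oplus>\<^bsub>quot_module u\<^esub>i\<in>I. quot_class u (g i))"
    by (rule M.add.finprod_mono_neutral_cong_left) (use assms car in auto)
  then show ?thesis using assms(1) by (simp add: finsum_quot_class)
qed

lemma is_direct_sum_cong:
  assumes "\<And>i. i \<in> I \<Longrightarrow> V i = W i"
  shows "is_direct_sum M I V \<longleftrightarrow> is_direct_sum M I W"
proof -
  have "(\<Pi>\<^sub>E i\<in>I. V i) = (\<Pi>\<^sub>E i\<in>I. W i)" by (rule PiE_cong) (rule assms)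
  then show ?thesis using assms by (simp add: is_direct_sum_def)
qed

lemma is_direct_sum_decompose:
  assumes "is_direct_sum M I V" "x \<in> carrier M"
  obtains f where "f \<in> (\<Pi>\<^sub>E i\<in>I. V i)" "x = (\<Oplus>\<^bsub>M\<^esub>i\<in>{i\<in>I. f i \<noteq> \<zero>\<^bsub>M\<^esub>}. f i)"
  using ex1_implies_ex[OF bspec[OF conjunct2[OF assms(1)[unfolded is_direct_sum_def]] assms(2)]]
  by (elim exE conjE)

section \<open>The upper bound: from cones to a Stanley decomposition\<close>

text \<open>A class modulo \<open>u\<close> is determined by its coefficients outside
  \<open>cone t UNIV\<close>, and the cones partition these exponents. Cutting a representative
  along the cones gives the components; comparing coefficients shows that they are unique.\<close>

lemma stanley_decomposition_quot:
  fixes u :: "('n::finite, 'k::field) mpoly"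
  assumes u: "u = Poly_Mapping.single t 1"
    and disj: "disjoint_family_on (\<lambda>l. cone (a l) (Z l)) {..<d}"
    and un: "(\<Union>l<d. cone (a l) (Z l)) = - cone t UNIV"
  shows "stanley_decomposition (quot_module u) (quot_grading u)
    (map (\<lambda>l. (quot_class u (Poly_Mapping.single (a l) 1), Z l)) [0..<d])"
proof -
  let ?M = "quot_module u"
  interpret module poly_ring ?M by (rule module_quot_module)
  let ?V = "\<lambda>l. quot_class u ` {q. Poly_Mapping.keys q \<subseteq> cone (a l) (Z l)}"
  let ?m = "\<lambda>l. quot_class u (Poly_Mapping.single (a l) 1)"
  have dvd: "u dvd p \<longleftrightarrow> Poly_Mapping.keys p \<subseteq> cone t UNIV" for p
    by (simp add: u monomial_dvd_iff)
  have inj: "inj_on (\<lambda>p. p \<odot>\<^bsub>?M\<^esub> ?m l) (polys_in (Z l))" if l: "l < d" for l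
  proof (rule inj_onI)
    fix p q :: "('n, 'k) mpoly"
    assume pq: "p \<in> polys_in (Z l)" "q \<in> polys_in (Z l)" "p \<odot>\<^bsub>?M\<^esub> ?m l = q \<odot>\<^bsub>?M\<^esub> ?m l"
    let ?r = "(p - q) * Poly_Mapping.single (a l) 1"
    have "p - q \<in> polys_in (Z l)"
      using pq(1,2) keys_diff[of p q] by (auto simp: polys_in_def)
    then have "Poly_Mapping.keys ?r \<subseteq> cone (a l) (Z l)"
      by (rule keys_mult_single_subset_cone)
    moreover have "Poly_Mapping.keys ?r \<subseteq> cone t UNIV"
      using pq(3) by (simp add: quot_module_simps quot_class_eq_iff dvd algebra_simps)
    moreover have "cone (a l) (Z l) \<inter> cone t UNIV = {}" using un l by blast
    ultimately have "?r = 0" by (metis le_inf_iff subset_empty keys_eq_empty)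
    \<comment> \<open>The coefficient of \<open>p - q\<close> at \<open>s\<close> is that of
      \<open>?r\<close> at \<open>s + a l\<close>.\<close>
    then have "p - q = 0"
      by (intro poly_mapping_eqI) (metis lookup_mult_single lookup_zero)
    then show "p = q" by simp
  qed
  have hom: "\<exists>b. ?m l \<in> quot_grading u b" for l
    by (rule exI[of _ "\<lambda>i. int (Poly_Mapping.lookup (a l) i)"])
       (auto simp: quot_grading_def poly_component_def)
  have sub: "additive_subgroup (?V l) ?M" for l
  proof (rule additive_subgroup.intro, rule M.add.subgroupI)
    show "?V l \<subseteq> carrier ?M" by (auto simp: quot_module_simps)
    have "Poly_Mapping.keys (0 :: ('n, 'k) mpoly) \<subseteq> cone (a l) (Z l)" by simp
    then show "?V l \<noteq> {}" by blast
    fix x assume "x \<in> ?V l"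
    then obtain p where p: "Poly_Mapping.keys p \<subseteq> cone (a l) (Z l)" "x = quot_class u p" by blast
    have "\<ominus>\<^bsub>?M\<^esub> x = quot_class u (- p)"
      by (rule M.minus_equality) (auto simp: p quot_module_simps)
    then show "\<ominus>\<^bsub>?M\<^esub> x \<in> ?V l" using p(1) by auto
    fix y assume "y \<in> ?V l"
    then obtain q where q: "Poly_Mapping.keys q \<subseteq> cone (a l) (Z l)" "y = quot_class u q" by blast
    have "Poly_Mapping.keys (p + q) \<subseteq> cone (a l) (Z l)"
      using keys_add[of p q] p(1) q(1) by blast
    then show "x \<oplus>\<^bsub>?M\<^esub> y \<in> ?V l" by (auto simp: p q quot_module_simps)
  qed
  have "\<exists>!f. f \<in> (\<Pi>\<^sub>E l\<in>{..<d}. ?V l) \<and> finite {l\<in>{..<d}. f l \<noteq> \<zero>\<^bsub>?M\<^esub>} \<and>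
       x = (\<Oplus>\<^bsub>?M\<^esub>l\<in>{l\<in>{..<d}. f l \<noteq> \<zero>\<^bsub>?M\<^esub>}. f l)" if "x \<in> carrier ?M" for x
  proof -
    from that obtain p where x: "x = quot_class u p" by (auto simp: quot_module_simps)
    have "\<forall>l. \<exists>q. \<forall>s. Poly_Mapping.lookup q s =
        (if s \<in> cone (a l) (Z l) then Poly_Mapping.lookup p s else 0)"
      using ex_restriction by blast
    then obtain r where r: "\<And>l s. Poly_Mapping.lookup (r l) s =
        (if s \<in> cone (a l) (Z l) then Poly_Mapping.lookup p s else 0)"
      by metis
    \<comment> \<open>By disjointness only the summand \<open>g l\<close> can contribute at an
      exponent of cone \<open>l\<close>.\<close>
    have sum_lookup: "Poly_Mapping.lookup (sum g {..<d}) s = Poly_Mapping.lookup (g l) s"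
      if g: "\<And>l. l < d \<Longrightarrow> Poly_Mapping.keys (g l) \<subseteq> cone (a l) (Z l)"
        and l: "l < d" and s: "s \<in> cone (a l) (Z l)" for g :: "nat \<Rightarrow> ('n, 'k) mpoly" and l s
    proof -
      have "Poly_Mapping.lookup (g k) s = 0" if k: "k \<in> {..<d} - {l}" for k
      proof -
        have "cone (a k) (Z k) \<inter> cone (a l) (Z l) = {}"
          using disj k l by (simp add: disjoint_family_on_def)
        then have "s \<notin> Poly_Mapping.keys (g k)" using g[of k] k s by auto
        then show ?thesis by (simp add: in_keys_iff)
      qed
      then show ?thesis
        using l by (simp add: lookup_sum sum.remove[of _ l "\<lambda>k. Poly_Mapping.lookup (g k) s"])
    qed
    have keys_r: "Poly_Mapping.keys (r l) \<subseteq> cone (a l) (Z l)" for l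
      by (auto simp: in_keys_iff r split: if_splits)
    have "Poly_Mapping.keys (p - sum r {..<d}) \<subseteq> cone t UNIV"
    proof
      fix s assume s: "s \<in> Poly_Mapping.keys (p - sum r {..<d})"
      show "s \<in> cone t UNIV"
      proof (rule ccontr)
        assume "s \<notin> cone t UNIV"
        then obtain l where "l < d" "s \<in> cone (a l) (Z l)" using un by blast
        then show False using s sum_lookup[OF keys_r, of l s] by (simp add: in_keys_iff lookup_minus r)
      qed
    qed
    then have x_r: "x = quot_class u (sum r {..<d})" by (simp add: x quot_class_eq_iff dvd)
    \<comment> \<open>The restricted abstraction gives the value outside the index set that
      \<open>PiE\<close> demands.\<close>
    let ?f = "\<lambda>l\<in>{..<d}. quot_class u (r l)"
    show ?thesis
    proof (rule ex1I[of _ ?f])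
      show "?f \<in> (\<Pi>\<^sub>E l\<in>{..<d}. ?V l) \<and> finite {l\<in>{..<d}. ?f l \<noteq> \<zero>\<^bsub>?M\<^esub>} \<and>
          x = (\<Oplus>\<^bsub>?M\<^esub>l\<in>{l\<in>{..<d}. ?f l \<noteq> \<zero>\<^bsub>?M\<^esub>}. ?f l)"
        using keys_r by (subst finsum_quot_class_nonzero[of _ _ _ r]) (auto simp: x_r)
      fix f assume f: "f \<in> (\<Pi>\<^sub>E l\<in>{..<d}. ?V l) \<and> finite {l\<in>{..<d}. f l \<noteq> \<zero>\<^bsub>?M\<^esub>} \<and>
          x = (\<Oplus>\<^bsub>?M\<^esub>l\<in>{l\<in>{..<d}. f l \<noteq> \<zero>\<^bsub>?M\<^esub>}. f l)"
      then have "f l \<in> ?V l" if "l \<in> {..<d}" for l using that by (elim conjE) (rule PiE_mem)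
      then have "\<forall>l\<in>{..<d}. \<exists>q. Poly_Mapping.keys q \<subseteq> cone (a l) (Z l) \<and> f l = quot_class u q"
        by blast
      then obtain g where g: "\<And>l. l < d \<Longrightarrow> Poly_Mapping.keys (g l) \<subseteq> cone (a l) (Z l)"
        "\<And>l. l < d \<Longrightarrow> f l = quot_class u (g l)"
        by (metis lessThan_iff)
      have "x = quot_class u (sum g {..<d})"
        using f finsum_quot_class_nonzero[of "{..<d}" f u g] g(2) by simp
      then have dvd_g: "Poly_Mapping.keys (p - sum g {..<d}) \<subseteq> cone t UNIV"
        by (simp add: x quot_class_eq_iff dvd)
      \<comment> \<open>On cone \<open>l\<close> both sides have the coefficients of
        \<open>p\<close>, because no multiple of \<open>u\<close> reaches there; off the cone both
        vanish.\<close>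
      have "g l = r l" if "l < d" for l
      proof (rule poly_mapping_eqI)
        fix s
        show "Poly_Mapping.lookup (g l) s = Poly_Mapping.lookup (r l) s"
        proof (cases "s \<in> cone (a l) (Z l)")
          case True
          then have "s \<notin> cone t UNIV" using un that by blast
          then have "s \<notin> Poly_Mapping.keys (p - sum g {..<d})" using dvd_g by blast
          then show ?thesis
            using True sum_lookup[OF g(1) that True] by (simp add: r in_keys_iff lookup_minus)
        next
          case False
          then show ?thesis using g(1)[OF that] by (auto simp: r in_keys_iff)
        qed
      qed
      then show "f = ?f"
        using f g(2) by (auto simp: fun_eq_iff PiE_iff extensional_def)
    qed
  qed
  then have "is_direct_sum ?M {..<d} ?V"
    unfolding is_direct_sum_def by (intro conjI ballI sub) simp_all
  then have "is_direct_sum ?M {..<d}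
      (\<lambda>l. stanley_space ?M (fst (map (\<lambda>l. (?m l, Z l)) [0..<d] ! l))
        (snd (map (\<lambda>l. (?m l, Z l)) [0..<d] ! l)))"
    by (rule is_direct_sum_cong[THEN iffD1, rotated]) (simp add: stanley_space_quot)
  then show ?thesis
    unfolding stanley_decomposition_def using inj hom by (auto simp: quot_module_simps)
qed

section \<open>The lower bound: counting spaces by missing variable and degree\<close>

lemma degree_le_stanley_length:
  fixes u :: "('n::finite, 'k::field) mpoly"
  assumes u: "u = Poly_Mapping.single t 1"
    and D: "stanley_decomposition (quot_module u) (quot_grading u) D"
  shows "(\<Sum>i\<in>UNIV. Poly_Mapping.lookup t i) \<le> length D"
proof -
  let ?M = "quot_module u"
  let ?I = "{..<length D}"
  define Z where "Z l = snd (D ! l)" for l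
  have D_nth: "\<exists>a. fst (D ! l) \<in> quot_grading u a"
    "inj_on (\<lambda>p. p \<odot>\<^bsub>?M\<^esub> fst (D ! l)) (polys_in (Z l))" if "l < length D" for l
    using D nth_mem[OF that] by (auto simp: stanley_decomposition_def Z_def split_beta)
  \<comment> \<open>Each generator is lifted to a homogeneous polynomial \<open>g l\<close> of
    degree \<open>\<alpha> l\<close>.\<close>
  have "\<forall>l\<in>?I. \<exists>\<alpha> g. g \<in> poly_component \<alpha> \<and> fst (D ! l) = quot_class u g"
  proof
    fix l assume "l \<in> ?I"
    then obtain \<alpha> where "fst (D ! l) \<in> quot_grading u \<alpha>" using D_nth(1) by blast
    then show "\<exists>\<alpha> g. g \<in> poly_component \<alpha> \<and> fst (D ! l) = quot_class u g"
      unfolding quot_grading_def by blast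
  qed
  then obtain \<alpha> g where g: "\<And>l. l < length D \<Longrightarrow> g l \<in> poly_component (\<alpha> l)"
    "\<And>l. l < length D \<Longrightarrow> fst (D ! l) = quot_class u (g l)"
    by (metis lessThan_iff)
  have Z: "Z l \<noteq> UNIV" if "l < length D" for l
  proof
    assume "Z l = UNIV"
    then have "inj_on (\<lambda>p. p \<odot>\<^bsub>?M\<^esub> quot_class u (g l)) UNIV"
      using D_nth(2)[OF that] g(2)[OF that] by (simp add: polys_in_def)
    moreover have "u \<odot>\<^bsub>?M\<^esub> quot_class u (g l) = 0 \<odot>\<^bsub>?M\<^esub> quot_class u (g l)"
      by (simp add: quot_module_simps quot_class_eq_iff)
    ultimately have "u = 0" by (auto dest: injD)
    then show False unfolding u by (metis keys_single keys_zero insert_not_empty one_neq_zero)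
  qed
  \<comment> \<open>Lifting the decomposition of the class of \<open>x^s\<close> changes it only by
    a multiple of \<open>u\<close>, which has no term at \<open>s\<close>. So \<open>s\<close>
    occurs in some \<open>p l * g l\<close>, and is the degree \<open>\<alpha> l\<close> plus an
    exponent in the variables of \<open>Z l\<close>.\<close>
  have cover: "\<exists>l<length D. \<forall>i. if i \<in> Z l then \<alpha> l i \<le> int (Poly_Mapping.lookup s i)
      else \<alpha> l i = int (Poly_Mapping.lookup s i)" if s: "s \<notin> cone t UNIV" for s
  proof -
    have "is_direct_sum ?M ?I (\<lambda>l. stanley_space ?M (fst (D ! l)) (snd (D ! l)))"
      using D by (simp add: stanley_decomposition_def)
    moreover have "quot_class u (Poly_Mapping.single s 1) \<in> carrier ?M"
      by (simp add: quot_module_simps)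
    ultimately obtain f where
      f: "f \<in> (\<Pi>\<^sub>E l\<in>?I. stanley_space ?M (fst (D ! l)) (snd (D ! l)))"
      "quot_class u (Poly_Mapping.single s 1) = (\<Oplus>\<^bsub>?M\<^esub>l\<in>{l\<in>?I. f l \<noteq> \<zero>\<^bsub>?M\<^esub>}. f l)"
      by (rule is_direct_sum_decompose)
    have "\<forall>l\<in>?I. \<exists>p\<in>polys_in (Z l). f l = quot_class u (p * g l)"
    proof
      fix l assume l: "l \<in> ?I"
      then have "f l \<in> stanley_space ?M (quot_class u (g l)) (Z l)"
        using f(1) g(2) by (auto simp: Z_def PiE_iff)
      then show "\<exists>p\<in>polys_in (Z l). f l = quot_class u (p * g l)"
        by (auto simp: stanley_space_def quot_module_simps)
    qed
    then obtain p where p: "\<And>l. l < length D \<Longrightarrow> p l \<in> polys_in (Z l)"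
      "\<And>l. l < length D \<Longrightarrow> f l = quot_class u (p l * g l)"
      by (metis lessThan_iff)
    let ?q = "\<Sum>l<length D. p l * g l"
    have "quot_class u (Poly_Mapping.single s 1) = quot_class u ?q"
      unfolding f(2) by (rule finsum_quot_class_nonzero) (use p(2) in auto)
    then have "Poly_Mapping.keys (Poly_Mapping.single s 1 - ?q) \<subseteq> cone t UNIV"
      by (simp add: quot_class_eq_iff u monomial_dvd_iff)
    then have "Poly_Mapping.lookup (Poly_Mapping.single s 1 - ?q) s = 0"
      using s by (auto simp: in_keys_iff)
    then have "s \<in> Poly_Mapping.keys ?q" by (simp add: lookup_minus in_keys_iff)
    then obtain l where l: "l < length D" "s \<in> Poly_Mapping.keys (p l * g l)"
      using keys_sum[of "\<lambda>l. p l * g l" ?I] by auto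
    then obtain b c where bc: "b \<in> Poly_Mapping.keys (p l)" "c \<in> Poly_Mapping.keys (g l)" "s = b + c"
      using keys_mult[of "p l" "g l"] by auto
    have "\<alpha> l i = int (Poly_Mapping.lookup c i)" for i
      using g(1)[OF l(1)] bc(2) by (auto simp: poly_component_def)
    moreover have "Poly_Mapping.keys b \<subseteq> Z l"
      using p(1)[OF l(1)] bc(1) by (auto simp: polys_in_def)
    ultimately show ?thesis
      using l(1) by (intro exI[of _ l]) (auto simp: bc(3) lookup_add in_keys_iff)
  qed
  \<comment> \<open>\<open>nat\<close> sends negative degree entries to 0, and \<open>Suc\<close>
    makes the bound strict.\<close>
  obtain N :: nat where N: "\<And>l i. l < length D \<Longrightarrow> \<alpha> l i < int N"
  proof
    let ?A = "(\<lambda>(l, i). nat (\<alpha> l i)) ` (?I \<times> UNIV)"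
    fix l i assume "l < length D"
    then have "nat (\<alpha> l i) \<le> Max ?A" by (intro Max_ge) auto
    then show "\<alpha> l i < int (Suc (Max ?A))" by linarith
  qed
  let ?P = "SIGMA i:UNIV. {..<Poly_Mapping.lookup t i}"
  have "\<forall>x\<in>?P. \<exists>l<length D. Z l = - {fst x} \<and> \<alpha> l (fst x) = int (snd x)"
  proof
    fix x assume "x \<in> ?P"
    then obtain i k where x: "x = (i, k)" "k < Poly_Mapping.lookup t i" by auto
    let ?s = "Abs_poly_mapping (\<lambda>j. if j = i then k else N)"
    have s: "Poly_Mapping.lookup ?s j = (if j = i then k else N)" for j
      by (subst lookup_Abs_poly_mapping) (auto intro: finite_subset[OF subset_UNIV])
    have "?s \<notin> cone t UNIV" using x(2) by (auto simp: mem_cone_iff s)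
    from cover[OF this] obtain l where l: "l < length D"
      "\<And>j. if j \<in> Z l then \<alpha> l j \<le> int (if j = i then k else N)
        else \<alpha> l j = int (if j = i then k else N)"
      unfolding s by blast
    \<comment> \<open>Otherwise \<open>\<alpha> l j\<close> would equal \<open>N\<close>, against
      the strict bound.\<close>
    have "j \<in> Z l" if "j \<noteq> i" for j
      using l(2)[of j] N[OF l(1), of j] that by (auto split: if_splits)
    moreover from this have "i \<notin> Z l" using Z[OF l(1)] by (metis UNIV_eq_I)
    ultimately have "Z l = - {i}" by auto
    then show "\<exists>l<length D. Z l = - {fst x} \<and> \<alpha> l (fst x) = int (snd x)"
      using l(1) l(2)[of i] x(1) by auto
  qed
  then obtain h where h: "\<And>x. x \<in> ?P \<Longrightarrow> h x < length D"
    "\<And>x. x \<in> ?P \<Longrightarrow> Z (h x) = - {fst x}" "\<And>x. x \<in> ?P \<Longrightarrow> \<alpha> (h x) (fst x) = int (snd x)"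
    by metis
  \<comment> \<open>The variable is read off from \<open>Z (h x)\<close>, and then the number
    \<open>k\<close> from the degree entry at that variable.\<close>
  have "inj_on h ?P"
  proof (rule inj_onI)
    fix x y assume xy: "x \<in> ?P" "y \<in> ?P" "h x = h y"
    then have "- {fst x} = - {fst y}" using h(2) by metis
    then have "fst x = fst y" by blast
    then show "x = y" using xy h(3) by (metis of_nat_eq_iff prod_eqI)
  qed
  then have "card ?P \<le> card ?I"
    by (rule card_inj_on_le) (use h(1) in auto)
  then show ?thesis by simp
qed

theorem proposition2p7:
  fixes u :: "('n::finite, 'k::field) mpoly"
    and t :: "'n \<Rightarrow>\<^sub>0 nat"
    and d :: nat
  assumes "u = Poly_Mapping.single t 1"
    and "(\<Sum>i\<in>UNIV. Poly_Mapping.lookup t i) = d"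
    and "d \<ge> 1"
  shows "slength (quot_module u) (quot_grading u) = enat d"
proof (rule antisym)
  obtain a Z where "disjoint_family_on (\<lambda>l. cone (a l) (Z l)) {..<d}"
    "(\<Union>l<d. cone (a l) (Z l)) = - cone t UNIV"
    using cone_chain_partition[OF assms(2)] by blast
  from stanley_decomposition_quot[OF assms(1) this]
  show "slength (quot_module u) (quot_grading u) \<le> enat d"
    unfolding slength_def by (intro INF_lower2) auto
  show "enat d \<le> slength (quot_module u) (quot_grading u)"
    unfolding slength_def using degree_le_stanley_length[OF assms(1)] assms(2)
    by (intro INF_greatest) auto
qed

end
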